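(* Let $X$ be a Lindelöf space and let $\kappa<\mathfrak{d}$ be a cardinal. If $X$ is a union of $\kappa$ many subspaces each of which is almost Hurewicz, then $X$ is almost Scheepers.
   Context: Lindelöf means that every open cover has a countable subcover (no separation axiom is assumed). A topological space $Z$ is almost Hurewicz if for every sequence $(\mathcal{U}_n)_{n\in\mathbb{N}}$ of open covers of $Z$ there are finite $\mathcal{V}_n\subseteq\mathcal{U}_n$ such that each $x\in Z$ belongs to $\overline{\bigcup\mathcal{V}_n}$ for all but finitely many $n$. $Z$ is almost Scheepers if for every sequence $(\mathcal{U}_n)_{n\in\mathbb{N}}$ of open covers of $Z$ there are finite $\mathcal{V}_n\subseteq\mathcal{U}_n$ such that every finite set $F\subseteq Z$ is contained in $\overline{\bigcup\mathcal{V}_n}$ for some $n$. For $f,g\in\mathbb{N}^{\mathbb{N}}$ write $f\leq^* g$ if $f(n)\leq g(n)$ for all but finitely many $n$. A set $D\subseteq\mathbb{N}^{\mathbb{N}}$ is dominating if for each $g\in\mathbb{N}^{\mathbb{N}}$ there is $f\in D$ with $g\leq^* f$; $\mathfrak{d}$ is the minimum cardinality of a dominating subset of $\mathbb{N}^{\mathbb{N}}$. *)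

theory Defs
  imports "HOL-Analysis.Lindelof_Spaces" "HOL-Library.Infinite_Set"
begin

unbundle cardinal_syntax

definition open_cover_of :: "'a topology \<Rightarrow> 'a set set \<Rightarrow> bool"
  where "open_cover_of Z \<U> \<longleftrightarrow> (\<forall>U\<in>\<U>. openin Z U) \<and> \<Union>\<U> = topspace Z"

definition almost_Hurewicz :: "'a topology \<Rightarrow> bool"
  where "almost_Hurewicz Z \<longleftrightarrow>
    (\<forall>\<U> :: nat \<Rightarrow> 'a set set. (\<forall>n. open_cover_of Z (\<U> n)) \<longrightarrow>
      (\<exists>\<V> :: nat \<Rightarrow> 'a set set. (\<forall>n. finite (\<V> n) \<and> \<V> n \<subseteq> \<U> n) \<and>
        (\<forall>x\<in>topspace Z. \<forall>\<^sub>\<infinity>n. x \<in> Z closure_of (\<Union>(\<V> n)))))"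

definition almost_Scheepers :: "'a topology \<Rightarrow> bool"
  where "almost_Scheepers Z \<longleftrightarrow>
    (\<forall>\<U> :: nat \<Rightarrow> 'a set set. (\<forall>n. open_cover_of Z (\<U> n)) \<longrightarrow>
      (\<exists>\<V> :: nat \<Rightarrow> 'a set set. (\<forall>n. finite (\<V> n) \<and> \<V> n \<subseteq> \<U> n) \<and>
        (\<forall>F. finite F \<and> F \<subseteq> topspace Z \<longrightarrow> (\<exists>n. F \<subseteq> Z closure_of (\<Union>(\<V> n))))))"

definition le_star :: "(nat \<Rightarrow> nat) \<Rightarrow> (nat \<Rightarrow> nat) \<Rightarrow> bool"  (infix "\<le>\<^sup>*" 50)
  where "f \<le>\<^sup>* g \<longleftrightarrow> (\<forall>\<^sub>\<infinity>n. f n \<le> g n)"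

definition dominating :: "(nat \<Rightarrow> nat) set \<Rightarrow> bool"
  where "dominating D \<longleftrightarrow> (\<forall>g. \<exists>f\<in>D. g \<le>\<^sup>* f)"

(* A cardinal is a relation r with Card_order r, compared with others via <o and \<le>o.
   The choice is well defined by dominating_number_least below. *)
definition dominating_number :: "(nat \<Rightarrow> nat) rel"
  where "dominating_number = |SOME D. dominating D \<and> (\<forall>E. dominating E \<longrightarrow> |D| \<le>o |E| )|"

lemma dominating_UNIV: "dominating UNIV"
  unfolding dominating_def le_star_def by (metis MOST_I UNIV_I order_refl)

lemma dominating_number_least:
  shows "\<exists>D. dominating D \<and> dominating_number = |D|"
    and "dominating E \<Longrightarrow> dominating_number \<le>o |E|"
proof -
  let ?R = "card_of ` {D. dominating D}"
  have "\<exists>r\<in>?R. \<forall>r'\<in>?R. r \<le>o r'"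
    by (rule exists_minim_Card_order) (use dominating_UNIV in \<open>auto simp: card_of_Card_order\<close>)
  then have ex: "\<exists>D. dominating D \<and> (\<forall>E. dominating E \<longrightarrow> |D| \<le>o |E| )"
    by auto
  show "\<exists>D. dominating D \<and> dominating_number = |D|"
    and "dominating E \<Longrightarrow> dominating_number \<le>o |E|"
    using someI_ex[OF ex] unfolding dominating_number_def by blast+
qed

end

theory Submission
  imports Defs "HOL-Algebra.Free_Abelian_Groups"
begin

text \<open>The closure of a set in a setoid shares this syntax; below, \<open>closure_of\<close> is
  the topological closure.\<close>

no_notation eq_closure_of ("closure'_of\<index>")

text \<open>Enumerate a countable subcover of each cover. Every almost Hurewicz piece \<open>A i\<close> then yields
  a function \<open>f i\<close> such that, for each point of \<open>A i\<close>, the first \<open>f i n\<close> members of the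
  \<open>n\<close>-th cover are enough for almost all \<open>n\<close>. The sums of finitely many \<open>f i\<close> form a family
  that is still smaller than \<open>\<dd>\<close>, so some \<open>g\<close> exceeds each of them infinitely often, and taking
  the first \<open>g n\<close> members of the \<open>n\<close>-th cover captures all finite sets.\<close>

lemma not_dominated_finite_subfamilies:
  fixes f :: "'k \<Rightarrow> nat \<Rightarrow> nat"
  assumes small: "|I| <o dominating_number"
  obtains g where "\<And>J. \<lbrakk>finite J; J \<subseteq> I\<rbrakk> \<Longrightarrow> \<exists>\<^sub>\<infinity>n. \<forall>i\<in>J. f i n \<le> g n"
\<comment> \<open>An infinite \<open>I\<close> has only |I| many finite subsets. For finite
  \<open>I\<close> that count fails, but the sum of the whole family bounds every member
  everywhere.\<close>
proof (cases "finite I")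
  case True
  define g where "g n = (\<Sum>i\<in>I. f i n)" for n
  have "\<exists>\<^sub>\<infinity>n. \<forall>i\<in>J. f i n \<le> g n" if "J \<subseteq> I" for J
  proof -
    have "f i n \<le> g n" if "i \<in> J" for i n
      unfolding g_def using that \<open>J \<subseteq> I\<close> True by (auto intro!: member_le_sum)
    then show ?thesis
      unfolding INFM_nat_le by blast
  qed
  then show ?thesis
    using that by blast
next
  case False
  \<comment> \<open>Escaping each \<open>f i\<close> separately would not do, since the infinite
    sets of good \<open>n\<close> could be disjoint. Exceeding the sum at \<open>n\<close> exceeds
    all \<open>f i n\<close> with \<open>i\<close> in \<open>J\<close> at the same
    \<open>n\<close>.\<close>
  define h where "h J n = (\<Sum>i\<in>J. f i n)" for J n
  have "|h ` Fpow I| \<le>o |Fpow I|"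
    by (rule card_of_image)
  also have "|Fpow I| =o |I|"
    using False by (rule card_of_Fpow_infinite)
  finally have "|h ` Fpow I| <o dominating_number"
    using small by (rule ordLeq_ordLess_trans)
  then have "\<not> dominating (h ` Fpow I)"
    using dominating_number_least(2) not_ordLess_ordLeq by blast
  then obtain g where g: "\<And>J. J \<in> Fpow I \<Longrightarrow> \<not> g \<le>\<^sup>* h J"
    unfolding dominating_def by blast
  have "\<exists>\<^sub>\<infinity>n. \<forall>i\<in>J. f i n \<le> g n" if J: "finite J" "J \<subseteq> I" for J
  proof -
    have "\<exists>\<^sub>\<infinity>n. h J n < g n"
      using g[of J] J by (simp add: Fpow_def le_star_def not_MOST not_le)
    moreover have "f i n \<le> h J n" if "i \<in> J" for i n
      unfolding h_def using that J by (auto intro!: member_le_sum)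
    ultimately show ?thesis
      by (elim INFM_mono) (meson le_less_trans less_imp_le)
  qed
  then show ?thesis
    using that by blast
qed

text \<open>The covers are traced on \<open>S\<close>, and the finite selections lifted back to
  members of \<open>C n\<close>. Being finite, each lifted selection has bounded codes and so lies
  in an initial segment.\<close>

lemma almost_Hurewicz_subtopology_initial_segments:
  fixes C :: "nat \<Rightarrow> 'a set set"
  assumes AH: "almost_Hurewicz (subtopology X S)"
    and S: "S \<subseteq> topspace X"
    and cover: "\<And>n. open_cover_of X (C n)"
  shows "\<exists>f. \<forall>x\<in>S. \<forall>\<^sub>\<infinity>n. x \<in> X closure_of (\<Union>{U \<in> C n. to_nat_on (C n) U \<le> f n})"
proof -
  have "open_cover_of (subtopology X S) ((\<inter>) S ` C n)" for n
    using cover[of n] S unfolding open_cover_of_def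
    by (auto simp: openin_subtopology_Int2)
  then have "\<exists>V. (\<forall>n. finite (V n) \<and> V n \<subseteq> (\<inter>) S ` C n) \<and>
      (\<forall>x\<in>topspace (subtopology X S). \<forall>\<^sub>\<infinity>n. x \<in> subtopology X S closure_of (\<Union>(V n)))"
    by (rule AH[unfolded almost_Hurewicz_def, rule_format])
  moreover have "topspace (subtopology X S) = S"
    using S by auto
  ultimately have "\<exists>V. (\<forall>n. finite (V n) \<and> V n \<subseteq> (\<inter>) S ` C n) \<and>
      (\<forall>x\<in>S. \<forall>\<^sub>\<infinity>n. x \<in> subtopology X S closure_of (\<Union>(V n)))"
    by simp
  then obtain V where V: "\<forall>n. finite (V n) \<and> V n \<subseteq> (\<inter>) S ` C n"
    and Vc: "\<forall>x\<in>S. \<forall>\<^sub>\<infinity>n. x \<in> subtopology X S closure_of (\<Union>(V n))"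
    by (elim exE conjE)
  have "\<exists>W. W \<subseteq> C n \<and> finite W \<and> V n = (\<inter>) S ` W" for n
    using V by (intro finite_subset_image) simp_all
  then obtain W where W: "\<And>n. W n \<subseteq> C n" "\<And>n. finite (W n)" "\<And>n. V n = (\<inter>) S ` W n"
    by metis
  \<comment> \<open>A sum serves as upper bound in place of a maximum, since \<open>W n\<close> may
    be empty; the bound is then 0.\<close>
  define f where "f n = (\<Sum>U\<in>W n. to_nat_on (C n) U)" for n
  have le: "\<Union>(V n) \<subseteq> \<Union>{U \<in> C n. to_nat_on (C n) U \<le> f n}" for n
  proof -
    have "to_nat_on (C n) U \<le> f n" if "U \<in> W n" for U
      unfolding f_def using W(2) that by (auto intro!: member_le_sum)
    then show ?thesis
      using W(1)[of n] unfolding W(3) by blast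
  qed
  \<comment> \<open>Closure in the subspace lies inside closure in \<open>X\<close>, so density
    passes from the piece to the whole space.\<close>
  have "subtopology X S closure_of (\<Union>(V n))
      \<subseteq> X closure_of (\<Union>{U \<in> C n. to_nat_on (C n) U \<le> f n})" for n
    using closure_of_subtopology_subset closure_of_mono[OF le] by (rule subset_trans)
  then have "\<forall>\<^sub>\<infinity>n. x \<in> X closure_of (\<Union>{U \<in> C n. to_nat_on (C n) U \<le> f n})"
    if "x \<in> S" for x
    by (rule MOST_mono[OF Vc[rule_format, OF that] subsetD])
  then show ?thesis
    by (intro exI[of _ f] ballI)
qed

theorem theorem3p10:
  fixes X :: "'a topology"
    and \<kappa> :: "'k rel"
    and A :: "'k \<Rightarrow> 'a set"
  assumes "Lindelof_space X"
    and "Card_order \<kappa>"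
    and "\<kappa> <o dominating_number"
    and "topspace X = (\<Union>i\<in>Field \<kappa>. A i)"
    and "\<And>i. i \<in> Field \<kappa> \<Longrightarrow> almost_Hurewicz (subtopology X (A i))"
  shows "almost_Scheepers X"
  unfolding almost_Scheepers_def
proof (intro allI impI)
  fix \<U> :: "nat \<Rightarrow> 'a set set"
  assume \<U>: "\<forall>n. open_cover_of X (\<U> n)"
  have "\<exists>C. countable C \<and> C \<subseteq> \<U> n \<and> \<Union>C = topspace X" for n
    using assms(1) \<U> unfolding Lindelof_space_def open_cover_of_def by simp
  then obtain C where C: "\<And>n. countable (C n)" "\<And>n. C n \<subseteq> \<U> n" "\<And>n. \<Union>(C n) = topspace X"
    by metis
  have cover: "open_cover_of X (C n)" for n
    using \<U> C unfolding open_cover_of_def by blast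
  define V where "V n k = {U \<in> C n. to_nat_on (C n) U \<le> k}" for n k :: nat
  \<comment> \<open>Here the Lindelof property pays off: \<open>to_nat_on\<close> is injective on
    the countable \<open>C n\<close>, so only finitely many members have code at most
    \<open>k\<close>.\<close>
  have fin: "finite (V n k)" for n k
  proof (rule inj_on_finite)
    show "inj_on (to_nat_on (C n)) (V n k)"
      by (rule inj_on_subset[OF inj_on_to_nat_on[OF C(1)]]) (auto simp: V_def)
    show "to_nat_on (C n) ` V n k \<subseteq> {..k}"
      by (auto simp: V_def)
  qed simp
  have "\<exists>f. \<forall>x\<in>A i. \<forall>\<^sub>\<infinity>n. x \<in> X closure_of (\<Union>(V n (f n)))" if i: "i \<in> Field \<kappa>" for i
  proof -
    have "A i \<subseteq> topspace X"
      using assms(4) i by blast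
    from almost_Hurewicz_subtopology_initial_segments[OF assms(5)[OF i] this cover]
    show ?thesis
      unfolding V_def .
  qed
  then have "\<exists>f. \<forall>i\<in>Field \<kappa>. \<forall>x\<in>A i. \<forall>\<^sub>\<infinity>n. x \<in> X closure_of (\<Union>(V n (f i n)))"
    by (intro bchoice ballI)
  then obtain f where f: "\<forall>i\<in>Field \<kappa>. \<forall>x\<in>A i. \<forall>\<^sub>\<infinity>n. x \<in> X closure_of (\<Union>(V n (f i n)))"
    by (elim exE)
  have "|Field \<kappa>| <o dominating_number"
    using card_of_Field_ordIso[OF assms(2)] assms(3) by (rule ordIso_ordLess_trans)
  then obtain g where g: "\<And>J. \<lbrakk>finite J; J \<subseteq> Field \<kappa>\<rbrakk> \<Longrightarrow> \<exists>\<^sub>\<infinity>n. \<forall>i\<in>J. f i n \<le> g n"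
    by (rule not_dominated_finite_subfamilies[where f = f]) blast
  have mono: "X closure_of (\<Union>(V n k)) \<subseteq> X closure_of (\<Union>(V n l))" if "k \<le> l" for n k l
    using that by (intro closure_of_mono) (fastforce simp: V_def)
  have "\<exists>n. F \<subseteq> X closure_of (\<Union>(V n (g n)))" if F: "finite F" "F \<subseteq> topspace X" for F
  proof -
    have "\<forall>x\<in>F. \<exists>i\<in>Field \<kappa>. x \<in> A i"
      using F(2) assms(4) by blast
    then obtain c where c: "\<And>x. x \<in> F \<Longrightarrow> c x \<in> Field \<kappa>" "\<And>x. x \<in> F \<Longrightarrow> x \<in> A (c x)"
      by metis
    have "\<exists>\<^sub>\<infinity>n. \<forall>i\<in>c ` F. f i n \<le> g n"
      using F(1) c(1) by (intro g) auto
    \<comment> \<open>Finitely many conditions, each true for almost all \<open>n\<close>, hold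
      jointly for almost all \<open>n\<close>, hence at some of the infinitely many \<open>n\<close>
      supplied by \<open>g\<close>.\<close>
    moreover have "\<forall>\<^sub>\<infinity>n. \<forall>x\<in>F. x \<in> X closure_of (\<Union>(V n (f (c x) n)))"
      using F(1) f c by (simp add: eventually_ball_finite)
    ultimately have "\<exists>\<^sub>\<infinity>n. (\<forall>i\<in>c ` F. f i n \<le> g n)
        \<and> (\<forall>x\<in>F. x \<in> X closure_of (\<Union>(V n (f (c x) n))))"
      by (rule INFM_conjI)
    then obtain n where n: "\<forall>i\<in>c ` F. f i n \<le> g n"
      "\<forall>x\<in>F. x \<in> X closure_of (\<Union>(V n (f (c x) n)))"
      by (elim INFM_E conjE)
    have "x \<in> X closure_of (\<Union>(V n (g n)))" if "x \<in> F" for x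
      using mono[of "f (c x) n" "g n" n] n that by auto
    then show ?thesis
      by blast
  qed
  moreover have "V n k \<subseteq> \<U> n" for n k
    using C(2) by (auto simp: V_def)
  ultimately show "\<exists>\<V>. (\<forall>n. finite (\<V> n) \<and> \<V> n \<subseteq> \<U> n) \<and>
      (\<forall>F. finite F \<and> F \<subseteq> topspace X \<longrightarrow> (\<exists>n. F \<subseteq> X closure_of (\<Union>(\<V> n))))"
    using fin by (intro exI[of _ "\<lambda>n. V n (g n)"]) simp
qed

end
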